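(* Let $q\ge 1$, $m\ge 0$, $S\in\mathrm{S}(m,q-1)$, and let $P=RL^q\,S\,C$, an MSS-sequence, have length $p$. If $P$ is non-primary, then there is an integer $r\ge 0$ such that $$P=RL^{q}\,RL^{q-1}\,(R^2L^{q-1})^{r}\,C,\qquad p=(r+2)(q+1).$$ Furthermore, these non-primary sequences can be written as $$RL^{q}\,RL^{q-1}\,(R^2L^{q-1})^{r}\,C = RL^{q-1}C * RL^{\frac{p}{q+1}-2}C ,$$ where $q+1$ divides $p$ and $q+1\neq 1,p$.
   Context: An admissible sequence is a finite word $A_1A_2\cdots A_p$ with $A_i\in\{R,L\}$ for $i<p$ and $A_p=C$. Put $L<C<R$. The parity-lexicographic order on admissible sequences: if $P^1\neq P^2$ and $i$ is the first index where they differ, then, if the common prefix of length $i-1$ contains an even number of $R$s, $P^1<P^2$ iff $A^1_i<A^2_i$; if it contains an odd number of $R$s, $P^1<P^2$ iff $A^2_i<A^1_i$. The right shifts of $P$ are $\sigma^k(P)=A_{k+1}\cdots A_p$; $P$ is shift maximal if it is greater than or equal to each of its right shifts. The MSS-sequences (for unimodal round-top concave maps) are exactly the shift maximal admissible sequences (results of Beyer, Mauldin and Stein); this is taken here as the meaning of "MSS-sequence". $\mathrm{S}(m,h)$ is the set of words in $R,L$ of length $m$ that start with $R$ and contain at most $h$ consecutive $L$s; for $m=0$ only the empty word is meant. Composition (Derrida–Gervois–Pomeau): for $O_h=x_1\cdots x_{h-1}C$ and $O_s=y_1\cdots y_{s-1}C$ with $x_i,y_j\in\{R,L\}$, put $Q=x_1\cdots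 x_{h-1}$. If $O_h$ contains an even number of $R$s, $O_h*O_s=Qy_1Qy_2\cdots y_{s-1}QC$; if it contains an odd number of $R$s, $O_h*O_s=Q\overline{y_1}Q\overline{y_2}\cdots\overline{y_{s-1}}QC$, where $\overline R=L$, $\overline L=R$. An MSS-sequence is non-primary if it equals $O_h*O_s$ for some MSS-sequences $O_h,O_s$ of length at least $2$, and primary otherwise. *)

theory Defs
  imports Main "HOL-Library.Sublist"
begin

datatype letter = L | C | R

text \<open>The order \<open>L < C < R\<close>.\<close>

instantiation letter :: linorder
begin

fun rank_letter :: "letter \<Rightarrow> nat" where
  "rank_letter L = 0"
| "rank_letter C = 1"
| "rank_letter R = 2"

definition less_eq_letter :: "letter \<Rightarrow> letter \<Rightarrow> bool" where
  "a \<le> b \<longleftrightarrow> rank_letter a \<le> rank_letter b"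

definition less_letter :: "letter \<Rightarrow> letter \<Rightarrow> bool" where
  "a < b \<longleftrightarrow> rank_letter a < rank_letter b"

instance
proof
  fix a b :: letter
  show "a \<le> b \<Longrightarrow> b \<le> a \<Longrightarrow> a = b"
    by (cases a; cases b) (simp_all add: less_eq_letter_def)
qed (auto simp: less_eq_letter_def less_letter_def)

end

type_synonym word = "letter list"

definition admissible :: "word \<Rightarrow> bool" where
  "admissible P \<longleftrightarrow> P \<noteq> [] \<and> set (butlast P) \<subseteq> {R, L} \<and> last P = C"

text \<open>
  The strict parity-lexicographic order; \<open>i\<close> is the (0-based) first position where the words differ.
  Two distinct admissible words always differ at a position occurring in both, since \<open>C\<close> occurs
  only at the end.
\<close>

definition parity_lex_less :: "word \<Rightarrow> word \<Rightarrow> bool" where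
  "parity_lex_less P1 P2 \<longleftrightarrow>
     (\<exists>i. i < length P1 \<and> i < length P2 \<and> take i P1 = take i P2 \<and> P1 ! i \<noteq> P2 ! i \<and>
        (if even (count_list (take i P1) R) then P1 ! i < P2 ! i else P2 ! i < P1 ! i))"

definition parity_lex_le :: "word \<Rightarrow> word \<Rightarrow> bool" where
  "parity_lex_le P1 P2 \<longleftrightarrow> P1 = P2 \<or> parity_lex_less P1 P2"

definition shift_maximal :: "word \<Rightarrow> bool" where
  "shift_maximal P \<longleftrightarrow> (\<forall>k < length P. parity_lex_le (drop k P) P)"

definition MSS :: "word \<Rightarrow> bool" where
  "MSS P \<longleftrightarrow> admissible P \<and> shift_maximal P"

definition S_words :: "nat \<Rightarrow> nat \<Rightarrow> word set" where
  "S_words m h = {w. length w = m \<and> set w \<subseteq> {R, L} \<and> (w \<noteq> [] \<longrightarrow> hd w = R) \<and>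
                     \<not> sublist (replicate (Suc h) L) w}"

fun flip :: "letter \<Rightarrow> letter" where
  "flip R = L"
| "flip L = R"
| "flip C = C"

text \<open>The Derrida--Gervois--Pomeau composition, meant for admissible words.\<close>

definition dgp_comp :: "word \<Rightarrow> word \<Rightarrow> word"  (infixl \<open>\<star>\<close> 70) where
  "Oh \<star> Os =
     (let Q = butlast Oh;
          f = (if even (count_list Oh R) then id else flip)
      in concat (map (\<lambda>y. Q @ [f y]) (butlast Os)) @ Q @ [C])"

definition non_primary :: "word \<Rightarrow> bool" where
  "non_primary P \<longleftrightarrow> MSS P \<and>
     (\<exists>Oh Os. MSS Oh \<and> MSS Os \<and> length Oh \<ge> 2 \<and> length Os \<ge> 2 \<and> P = Oh \<star> Os)"

definition primary :: "word \<Rightarrow> bool" where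
  "primary P \<longleftrightarrow> MSS P \<and> \<not> non_primary P"

end

theory Submission
  imports Defs
begin

text \<open>
  Write \<open>P = Q f(y\<^sub>1) Q f(y\<^sub>2) \<dots> Q C\<close> and \<open>Q = R Q'\<close>. The block \<open>L\<^sup>q\<close> does not occur in \<open>S\<close>, so
  it cannot lie inside \<open>Q'\<close>, which recurs in the last copy of \<open>Q\<close>. Hence the initial block \<open>L\<^sup>q\<close> of \<open>P\<close>
  reaches past the first \<open>Q\<close>; it cannot reach the second \<open>Q\<close>, which starts with \<open>R\<close>, so
  \<open>Q = R L\<^sup>q\<^sup>-\<^sup>1\<close> and \<open>f(y\<^sub>1) = L\<close>. Every later \<open>f(y\<^sub>i)\<close> must be \<open>R\<close>, since \<open>Q L\<close> contains \<open>L\<^sup>q\<close>.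
\<close>

lemma concat_replicate_rotate:
  "concat (replicate n (xs @ ys)) @ xs = xs @ concat (replicate n (ys @ xs))"
  by (induction n) simp_all

lemma admissibleE:
  assumes "admissible P"
  obtains Q where "P = Q @ [C]" "set Q \<subseteq> {R, L}"
  using assms append_butlast_last_id[of P] unfolding admissible_def by metis

text \<open>Applied with \<open>A\<close> the first copy of \<open>Q\<close> without its leading
  \<open>R\<close>, \<open>x\<close> the letter after it, and \<open>R # T\<close> the rest up to
  the final \<open>C\<close>; \<open>suffix\<close> holds because that rest ends in a copy of
  \<open>Q\<close>.\<close>

lemma initial_block_split:
  assumes eq: "A @ [x] @ R # T = replicate q L @ S"
    and suffix: "suffix A (R # T)"
    and free: "\<not> sublist (replicate q L) S"
    and q: "q \<ge> 1"
  shows "A = replicate (q - 1) L" "x = L" "S = R # T"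
proof -
  \<comment> \<open>The boundary case \<open>A = replicate q L\<close> goes to the first
    alternative, so \<open>us\<close> is nonempty in the second.\<close>
  consider us where "A = replicate q L @ us" "us @ [x] @ R # T = S"
    | us where "us \<noteq> []" "A @ us = replicate q L" "[x] @ R # T = us @ S"
    using eq by (cases "A = replicate q L") (fastforce simp: append_eq_append_conv2)+
  then have "A = replicate (q - 1) L \<and> x = L \<and> S = R # T"
  proof cases
    case 1
    then obtain vs where "R # T = vs @ replicate q L @ us"
      using suffix by (auto simp: suffix_def)
    then have "S = (us @ [x] @ vs) @ replicate q L @ us"
      using 1(2) by simp
    then show ?thesis
      using free by (metis sublist_def)
  next
    case 2
    have set_us: "set us \<subseteq> {L}"
      using arg_cong[OF 2(2), of set] by (auto simp: set_replicate_conv_if split: if_splits)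
    obtain us' where us: "us = x # us'" "R # T = us' @ S"
      using 2(1,3) by (cases us) auto
    \<comment> \<open>A nonempty \<open>us'\<close> would begin with the \<open>R\<close> of
      \<open>R # T\<close>, but \<open>us\<close> consists of \<open>L\<close>s.\<close>
    have "us' = []"
      using us set_us by (cases us') auto
    then have "A @ [L] = replicate q L" "x = L"
      using us set_us 2(2) by auto
    then show ?thesis
      using us(2) \<open>us' = []\<close> q by (cases q) (auto simp: replicate_append_same[symmetric])
  qed
  then show "A = replicate (q - 1) L" "x = L" "S = R # T" by auto
qed

theorem theorem7:
  fixes q m p :: nat and S P :: word
  assumes "q \<ge> 1"
    and "S \<in> S_words m (q - 1)"
    and "P = [R] @ replicate q L @ S @ [C]"
    and "MSS P"
    and "length P = p"
    and "non_primary P"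
  shows "\<exists>r::nat.
     P = [R] @ replicate q L @ [R] @ replicate (q - 1) L
           @ concat (replicate r ([R, R] @ replicate (q - 1) L)) @ [C] \<and>
     p = (r + 2) * (q + 1) \<and>
     [R] @ replicate q L @ [R] @ replicate (q - 1) L
           @ concat (replicate r ([R, R] @ replicate (q - 1) L)) @ [C]
       = ([R] @ replicate (q - 1) L @ [C]) \<star> ([R] @ replicate (p div (q + 1) - 2) L @ [C]) \<and>
     (q + 1) dvd p \<and> q + 1 \<noteq> 1 \<and> q + 1 \<noteq> p"
proof -
  obtain Oh Os where O: "MSS Oh" "MSS Os" "length Oh \<ge> 2" "length Os \<ge> 2" "P = Oh \<star> Os"
    using assms(6) by (auto simp: non_primary_def)
  obtain Q where Q: "Oh = Q @ [C]" "set Q \<subseteq> {R, L}"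
    using O(1) by (auto simp: MSS_def elim: admissibleE)
  obtain Y where Y: "Os = Y @ [C]" "set Y \<subseteq> {R, L}"
    using O(2) by (auto simp: MSS_def elim: admissibleE)
  obtain y ys where yys: "Y = y # ys" using O(4) Y(1) by (cases Y) auto
  define f where "f = (if even (count_list Oh R) then id else flip)"
  define T where "T = concat (map (\<lambda>y. Q @ [f y]) ys) @ Q"
  have P: "P = Q @ [f y] @ T @ [C]"
    using O(5) by (simp add: dgp_comp_def Q(1) Y(1) yys f_def T_def Let_def)
  have free: "\<not> sublist (replicate q L) S"
    using assms(1,2) by (simp add: S_words_def)
  obtain Q' where Q': "Q = R # Q'"
    using O(3) Q(1) P assms(3) by (cases Q) auto
  obtain T' where T': "T = R # T'"
    by (cases ys) (auto simp: T_def Q')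
  have eq: "Q' @ [f y] @ R # T' = replicate q L @ S"
    using P assms(3) by (simp add: Q' T')
  have "suffix Q' (R # T')"
    by (simp add: T'[symmetric] T_def Q' suffix_def)
  from initial_block_split[OF eq this free assms(1)]
  have split: "Q' = replicate (q - 1) L" "f y = L" "S = T"
    by (simp_all add: T')
  \<comment> \<open>\<open>Q\<close> is \<open>R\<close> followed by \<open>q - 1\<close> letters
    \<open>L\<close>: a single \<open>R\<close>, so the composition flips.\<close>
  have odd: "odd (count_list (Q @ [C]) R)"
    by (simp add: Q' split(1))
  then have f: "f = flip"
    by (simp add: f_def Q(1))
  have y: "y = R"
    using split(2) by (cases y) (simp_all add: f)
  have "z = L" if z: "z \<in> set ys" for z
  proof (rule ccontr)
    assume "z \<noteq> L"
    then have "f z = L"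
      using z Y(2) yys by (auto simp: f)
    obtain us vs where "ys = us @ z # vs"
      using z by (auto simp: in_set_conv_decomp)
    then have "S = (concat (map (\<lambda>y. Q @ [f y]) us) @ [R]) @ (Q' @ [L])
        @ concat (map (\<lambda>y. Q @ [f y]) vs) @ Q"
      using \<open>f z = L\<close> by (simp add: split(3) T_def Q')
    moreover have "Q' @ [L] = replicate q L"
      using assms(1) by (cases q) (simp_all add: split(1) replicate_append_same)
    ultimately show False
      using free by (metis sublist_def)
  qed
  then obtain r where ys: "ys = replicate r L"
    by (metis replicate_eqI)
  \<comment> \<open>Each \<open>L\<close> in \<open>ys\<close> flips to \<open>R\<close>, so
    \<open>T\<close> is \<open>(QR)^r Q\<close>; regrouping as \<open>Q (RQ)^r\<close> exposes the
    blocks \<open>[R, R] @ replicate (q - 1) L\<close>.\<close>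
  have T: "T = Q @ concat (replicate r ([R] @ Q))"
    using concat_replicate_rotate[of r Q "[R]"] by (simp add: T_def ys f)
  have Lq: "replicate q L = Q' @ [L]"
    using assms(1) by (cases q) (simp_all add: split(1) replicate_append_same)
  have form: "P = [R] @ replicate q L @ [R] @ replicate (q - 1) L
           @ concat (replicate r ([R, R] @ replicate (q - 1) L)) @ [C]"
    using P by (simp add: T split(1,2) Q' Lq)
  \<comment> \<open>Each of the \<open>r + 2\<close> letters of \<open>Os\<close> accounts for a
    copy of \<open>Q\<close>, of length \<open>q\<close>, and one more letter.\<close>
  have len: "p = (r + 2) * (q + 1)"
    using assms(1,5) form
    by (cases q) (simp_all add: length_concat sum_list_replicate algebra_simps)
  then have "p div (q + 1) - 2 = r"
    by (metis add_diff_cancel_right' add_is_0 nonzero_mult_div_cancel_right one_neq_zero)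
  moreover have "P = ([R] @ replicate (q - 1) L @ [C]) \<star> ([R] @ replicate r L @ [C])"
    using O(5) by (simp add: Q Q' split(1) Y(1) yys y ys)
  ultimately show ?thesis
    using form len assms(1) by (intro exI[of _ r]) (simp del: mult_Suc mult_Suc_right)
qed

end
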